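(* Let $a\in M_2$ be singular and nonzero. Then $SP(a;1)$ is the set of inverses of $a$ (in the semigroup-theoretic sense), and $SP(a;1)$ is a hyperbolic paraboloid.
   Context: $M_2$ is the semigroup of linear endomorphisms of a real plane, represented as the multiplicative semigroup of real $2\times 2$ matrices relative to a fixed ordered orthonormal basis, and identified with $\mathbb{R}^4$ by listing entries row-wise, with the usual inner product $\langle x,y\rangle = \operatorname{tr}(x^* y)$, where $x^*$ is the transpose of $x$. $\mathsf{S}_2$ is the set of singular matrices in $M_2$. For $a\in M_2$ and $\lambda\in\mathbb{R}$, $P(a;\lambda)=\{x\in M_2 : \operatorname{tr}(ax)=\lambda\}$ and $SP(a;\lambda)=P(a;\lambda)\cap \mathsf{S}_2$. For $a\neq 0$, $P(a;\lambda)$ is a three-dimensional affine subspace of $\mathbb{R}^4$ with the induced Euclidean structure. An element $x$ of a semigroup is an inverse of $a$ if $axa=a$ and $xax=x$. A subset of a three-dimensional Euclidean affine space $H$ is a hyperbolic paraboloid if there are rectangular Cartesian (orthonormal) coordinates $(X,Y,Z)$ on $H$, with some origin in $H$, and reals $p,q>0$ such that the subset is the full solution set of $Z = X^2/p^2-Y^2/q^2$; here $H=P(a;1)$. *)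

theory Defs
  imports "HOL-Analysis.Analysis"
begin

definition singular_matrices :: "(real^2^2) set"
  where "singular_matrices = {x. \<not> invertible x}"

definition trace_plane :: "real^2^2 \<Rightarrow> real \<Rightarrow> (real^2^2) set"
  where "trace_plane a l = {x. trace (a ** x) = l}"

definition singular_trace_plane :: "real^2^2 \<Rightarrow> real \<Rightarrow> (real^2^2) set"
  where "singular_trace_plane a l = trace_plane a l \<inter> singular_matrices"

(* f is the semigroup operation; the predicate is only meaningful for associative f. *)
definition semigroup_inverse :: "('a \<Rightarrow> 'a \<Rightarrow> 'a) \<Rightarrow> 'a \<Rightarrow> 'a \<Rightarrow> bool"
  where "semigroup_inverse f a x \<longleftrightarrow> f (f a x) a = a \<and> f (f x a) x = x"

(* The coordinate map (X, Y, Z) \<mapsto> c + X u + Y v + Z w is an isometry onto its range, so the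
   range condition forces H to be a three-dimensional affine subspace with c \<in> H. *)
definition cartesian_coordinates ::
    "'a::real_inner set \<Rightarrow> 'a \<Rightarrow> 'a \<Rightarrow> 'a \<Rightarrow> 'a \<Rightarrow> bool"
  where "cartesian_coordinates H c u v w \<longleftrightarrow>
    norm u = 1 \<and> norm v = 1 \<and> norm w = 1 \<and>
    orthogonal u v \<and> orthogonal u w \<and> orthogonal v w \<and>
    H = {c + X *\<^sub>R u + Y *\<^sub>R v + Z *\<^sub>R w | X Y Z. True}"

definition hyperbolic_paraboloid_in :: "'a::real_inner set \<Rightarrow> 'a set \<Rightarrow> bool"
  where "hyperbolic_paraboloid_in H S \<longleftrightarrow>
    (\<exists>c u v w p q. cartesian_coordinates H c u v w \<and> 0 < p \<and> 0 < q \<and>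
      S = {c + X *\<^sub>R u + Y *\<^sub>R v + Z *\<^sub>R w | X Y Z. Z = X\<^sup>2 / p\<^sup>2 - Y\<^sup>2 / q\<^sup>2})"

(* The library inner product on nested vectors is the trace form, i.e. the Euclidean structure
   of R^4 on the entries. *)
lemma inner_matrix_eq_trace:
  fixes x y :: "real^2^2"
  shows "x \<bullet> y = trace (transpose x ** y)"
  by (simp add: inner_vec_def trace_def transpose_def matrix_matrix_mult_def sum_2)

end

theory Submission
  imports Defs
begin

text \<open>
  For singular \<open>a\<close>, the identity \<open>a x a = tr (a x) a - det a adj x\<close> shows that the inverses of \<open>a\<close>
  are the singular \<open>x\<close> with \<open>tr (a x) = 1\<close>. If \<open>a = s f e\<^sup>T\<close> with unit vectors \<open>e\<close>, \<open>f\<close> and \<open>e'\<close>, \<open>f'\<close>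
  are these vectors turned by a right angle, then the plane consists of the matrices
  \<open>e f\<^sup>T / s + \<alpha> e f'\<^sup>T + \<beta> e' f\<^sup>T + Z e' f'\<^sup>T\<close>, whose determinant is \<open>Z / s - \<alpha> \<beta>\<close>.
  Rotating \<open>(\<alpha>, \<beta>)\<close> by \<open>\<pi>/4\<close> turns the singular ones into \<open>Z = s (X\<^sup>2 - Y\<^sup>2) / 2\<close>. The rotated frame
  has entries that are linear in those of \<open>a / s\<close>, so \<open>e\<close> and \<open>f\<close> need not be chosen.
\<close>

definition mat22 :: "real \<Rightarrow> real \<Rightarrow> real \<Rightarrow> real \<Rightarrow> real^2^2"
  where "mat22 p q r s = vector [vector [p, q], vector [r, s]]"

lemma mat22_nth [simp]:
  "mat22 p q r s $ 1 $ 1 = p" "mat22 p q r s $ 1 $ 2 = q"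
  "mat22 p q r s $ 2 $ 1 = r" "mat22 p q r s $ 2 $ 2 = s"
  by (simp_all add: mat22_def)

lemma mat22_cases:
  obtains p q r s where "x = mat22 p q r s"
proof
  show "x = mat22 (x$1$1) (x$1$2) (x$2$1) (x$2$2)"
    by (simp add: vec_eq_iff forall_2)
qed

lemma mat22_eq_iff [simp]:
  "mat22 p q r s = mat22 p' q' r' s' \<longleftrightarrow> p = p' \<and> q = q' \<and> r = r' \<and> s = s'"
  by (auto simp: vec_eq_iff forall_2)

lemma mat22_mult:
  "mat22 p q r s ** mat22 p' q' r' s' =
    mat22 (p * p' + q * r') (p * q' + q * s') (r * p' + s * r') (r * q' + s * s')"
  by (simp add: vec_eq_iff forall_2 matrix_matrix_mult_def sum_2)

lemma mat22_add: "mat22 p q r s + mat22 p' q' r' s' = mat22 (p + p') (q + q') (r + r') (s + s')"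
  by (simp add: vec_eq_iff forall_2)

lemma mat22_scaleR: "k *\<^sub>R mat22 p q r s = mat22 (k * p) (k * q) (k * r) (k * s)"
  by (simp add: vec_eq_iff forall_2)

lemma inner_mat22: "mat22 p q r s \<bullet> mat22 p' q' r' s' = p * p' + q * q' + r * r' + s * s'"
  by (simp add: inner_vec_def sum_2)

lemma trace_mat22: "trace (mat22 p q r s) = p + s"
  by (simp add: trace_def sum_2)

lemma mat22_mem_singular_matrices_iff:
  "mat22 p q r s \<in> singular_matrices \<longleftrightarrow> p * s = q * r"
  by (simp add: singular_matrices_def invertible_det_nz det_2)

lemma mat22_mem_trace_plane_iff:
  "mat22 p q r s \<in> trace_plane (mat22 A B C D) l \<longleftrightarrow> A * p + B * r + C * q + D * s = l"
  by (simp add: trace_plane_def mat22_mult trace_mat22 algebra_simps)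

text \<open>A singular matrix is a column times a row, so in the product the middle part, row times
  \<open>x\<close> times column, is a scalar: it equals \<open>trace (a ** x)\<close>.\<close>

lemma singular_sandwich:
  fixes a x :: "real^2^2"
  assumes "a \<in> singular_matrices"
  shows "(a ** x) ** a = trace (a ** x) *\<^sub>R a"
proof -
  obtain A B C D where a: "a = mat22 A B C D" by (rule mat22_cases)
  obtain p q r s where x: "x = mat22 p q r s" by (rule mat22_cases)
  have "A * D = B * C"
    using assms by (simp add: a mat22_mem_singular_matrices_iff)
  then show ?thesis
    unfolding a x mat22_mult trace_mat22 mat22_scaleR mat22_eq_iff
    by (intro conjI; algebra)
qed

lemma singular_trace_plane_eq_inverses:
  fixes a :: "real^2^2"
  assumes "a \<in> singular_matrices" and "a \<noteq> 0"
  shows "singular_trace_plane a 1 = {x. semigroup_inverse (**) a x}"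
proof (intro set_eqI iffI)
  fix x assume "x \<in> singular_trace_plane a 1"
  then have "trace (a ** x) = 1" and "x \<in> singular_matrices"
    by (auto simp: singular_trace_plane_def trace_plane_def)
  \<comment> \<open>Since \<open>x\<close> is singular too, \<open>singular_sandwich\<close> with
    \<open>a\<close> and \<open>x\<close> exchanged turns this trace into the second inverse
    equation.\<close>
  moreover from this have "trace (x ** a) = 1"
    by (metis trace_mul_sym)
  ultimately show "x \<in> {x. semigroup_inverse (**) a x}"
    using assms by (simp add: semigroup_inverse_def singular_sandwich)
next
  fix x assume "x \<in> {x. semigroup_inverse (**) a x}"
  then have axa: "(a ** x) ** a = a" and xax: "(x ** a) ** x = x"
    by (auto simp: semigroup_inverse_def)
  have "trace (a ** x) = 1"
    using axa assms scaleR_cancel_right[of "trace (a ** x)" a 1] by (simp add: singular_sandwich)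
  \<comment> \<open>Taking determinants in \<open>xax\<close> produces the factor
    \<open>det a = 0\<close>.\<close>
  moreover have "det x = 0"
    using assms(1) arg_cong[OF xax, of det]
    by (simp add: det_mul singular_matrices_def invertible_det_nz)
  ultimately show "x \<in> singular_trace_plane a 1"
    by (simp add: singular_trace_plane_def trace_plane_def singular_matrices_def invertible_det_nz)
qed

lemma singular_trace_plane_hyperbolic_paraboloid:
  fixes a :: "real^2^2"
  assumes "a \<in> singular_matrices" and "a \<noteq> 0"
  shows "hyperbolic_paraboloid_in (trace_plane a 1) (singular_trace_plane a 1)"
proof -
  define s where "s = norm a"
  have s: "s > 0" using assms(2) by (simp add: s_def)
  define k where "k = 1 / s"
  obtain A B C D where a': "a /\<^sub>R s = mat22 A B C D" by (rule mat22_cases)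
  have a: "a = mat22 (s * A) (s * B) (s * C) (s * D)"
    using s by (simp add: mat22_scaleR[symmetric] a'[symmetric])
  have det: "A * D = B * C"
    using assms(1) s by (simp add: a mat22_mem_singular_matrices_iff)
  have "norm (mat22 A B C D) = 1"
    using s by (simp add: a'[symmetric] s_def)
  then have unit: "A * A + B * B + C * C + D * D = 1"
    by (simp add: norm_eq_1 inner_mat22)
  have plane: "mat22 p q r t \<in> trace_plane a 1 \<longleftrightarrow> A * p + B * r + C * q + D * t = k"
    for p q r t
    using s by (simp add: a mat22_mem_trace_plane_iff k_def field_simps)
  define h :: real where "h = 1 / sqrt 2"
  have hh: "h * h = 1 / 2"
    by (simp add: h_def)
  \<comment> \<open>With \<open>a / s = f e^T\<close> and right angles turned counterclockwise,
    \<open>U\<close> and \<open>V\<close> are the sum and difference of \<open>e f'^T\<close> and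
    \<open>e' f^T\<close>, both of norm \<open>sqrt 2\<close>; \<open>w\<close> is
    \<open>e' f'^T\<close>.\<close>
  define U where "U = mat22 (- (B + C)) (A - D) (A - D) (B + C)"
  define V where "V = mat22 (B - C) (A + D) (- (A + D)) (B - C)"
  \<comment> \<open>The foot of the perpendicular from 0: \<open>mat22 A C B D\<close> is the unit
    normal of the plane, the transpose of \<open>a / s\<close>.\<close>
  define c where "c = k *\<^sub>R mat22 A C B D"
  define u where "u = h *\<^sub>R U"
  define v where "v = h *\<^sub>R V"
  define w where "w = mat22 D (- B) (- C) A"
  note frame = c_def u_def v_def U_def V_def w_def
  define pt where "pt X Y Z = c + X *\<^sub>R u + Y *\<^sub>R v + Z *\<^sub>R w" for X Y Z
  have pt_in: "pt X Y Z \<in> trace_plane a 1" for X Y Z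
    unfolding pt_def frame mat22_scaleR mat22_add plane
    using det unit by algebra
  have pt_surj: "\<exists>X Y Z. x = pt X Y Z" if x: "x \<in> trace_plane a 1" for x
  proof -
    obtain x1 x2 x3 x4 where xx: "x = mat22 x1 x2 x3 x4" by (rule mat22_cases)
    have tr: "A * x1 + B * x3 + C * x2 + D * x4 = k"
      using x by (simp add: xx plane)
    have half: "(x \<bullet> (h *\<^sub>R y)) *\<^sub>R (h *\<^sub>R y) = ((x \<bullet> y) / 2) *\<^sub>R y" for y
      using hh by (simp add: mult.commute mult.left_commute)
    \<comment> \<open>This expands \<open>x\<close> in an orthogonal basis of the whole matrix
      space: by \<open>tr\<close>, \<open>c\<close> is the component of \<open>x\<close> along the
      normal.\<close>
    have "x = c + ((x \<bullet> U) / 2) *\<^sub>R U + ((x \<bullet> V) / 2) *\<^sub>R V + (x \<bullet> w) *\<^sub>R w"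
      unfolding frame xx mat22_scaleR mat22_add inner_mat22 mat22_eq_iff tr[symmetric]
      using det unit by (intro conjI; algebra)
    then have "x = pt (x \<bullet> u) (x \<bullet> v) (x \<bullet> w)"
      by (simp only: pt_def u_def v_def half)
    then show ?thesis by blast
  qed
  have "cartesian_coordinates (trace_plane a 1) c u v w"
    unfolding cartesian_coordinates_def
  proof (intro conjI)
    show "norm u = 1" "norm v = 1" "norm w = 1"
      unfolding norm_eq_1 frame mat22_scaleR inner_mat22 using det unit hh by algebra+
    show "orthogonal u v" "orthogonal u w" "orthogonal v w"
      unfolding orthogonal_def frame mat22_scaleR inner_mat22 by (simp_all add: algebra_simps)
    show "trace_plane a 1 = {c + X *\<^sub>R u + Y *\<^sub>R v + Z *\<^sub>R w | X Y Z. True}"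
      using pt_in pt_surj unfolding pt_def by blast
  qed
  \<comment> \<open>Solving \<open>2 * (k * Z) = X^2 - Y^2\<close> for \<open>Z\<close> with
    \<open>k = 1 / s\<close> gives \<open>p^2 = q^2 = 2 / s\<close>.\<close>
  moreover have "singular_trace_plane a 1 =
      {c + X *\<^sub>R u + Y *\<^sub>R v + Z *\<^sub>R w | X Y Z. Z = X\<^sup>2 / (sqrt (2 / s))\<^sup>2 - Y\<^sup>2 / (sqrt (2 / s))\<^sup>2}"
  proof -
    have "pt X Y Z \<in> singular_matrices \<longleftrightarrow> 2 * (k * Z) = X\<^sup>2 - Y\<^sup>2" for X Y Z
    proof -
      define d where "d = det (pt X Y Z)"
      \<comment> \<open>A polynomial identity, grouped so that \<open>A * D - B * C\<close> and the
        sum of squares, whose values are 0 and 1, appear as blocks.\<close>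
      have "d = (k * k + Z * Z) * (A * D - B * C) + k * Z * (A * A + B * B + C * C + D * D)
          - h * h * X\<^sup>2 * (A * A + B * B + C * C + D * D - 2 * (A * D - B * C))
          + h * h * Y\<^sup>2 * (A * A + B * B + C * C + D * D + 2 * (A * D - B * C))"
        unfolding d_def det_2 pt_def frame mat22_scaleR mat22_add mat22_nth
        by (simp add: algebra_simps power2_eq_square)
      then have "2 * d = 2 * (k * Z) - (X\<^sup>2 - Y\<^sup>2)"
        unfolding det unit hh by simp
      then show ?thesis
        by (auto simp: singular_matrices_def invertible_det_nz d_def)
    qed
    also have "2 * (k * Z) = X\<^sup>2 - Y\<^sup>2 \<longleftrightarrow>
        Z = X\<^sup>2 / (sqrt (2 / s))\<^sup>2 - Y\<^sup>2 / (sqrt (2 / s))\<^sup>2" for X Y Z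
      using s by (auto simp: k_def field_simps)
    finally show ?thesis
      using pt_in pt_surj unfolding singular_trace_plane_def pt_def by blast
  qed
  moreover have "0 < sqrt (2 / s)" using s by simp
  ultimately show ?thesis
    unfolding hyperbolic_paraboloid_in_def by blast
qed

theorem proposition5:
  fixes a :: "real^2^2"
  assumes "a \<in> singular_matrices" and "a \<noteq> 0"
  shows "singular_trace_plane a 1 = {x. semigroup_inverse (**) a x} \<and>
    hyperbolic_paraboloid_in (trace_plane a 1) (singular_trace_plane a 1)"
  using singular_trace_plane_eq_inverses[OF assms]
    singular_trace_plane_hyperbolic_paraboloid[OF assms] by blast

end
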